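(* Let $S$ be a semiring and let $\Gamma \subseteq \mathrm{Ass}(S)$ satisfy the prime avoidance property. Let $B$ be an amount $S$-semialgebra with amount function $A: B\to\mathrm{Id}(S)$. If $Z(S)$ is controlled by $\Gamma$ and $B$ is a McCoy $S$-semialgebra (with respect to $A$), then $Z(B)$ is controlled by the set of all $\mathfrak{p}^{\epsilon}$ with $\mathfrak{p} \in \Gamma$; that is, the $\mathfrak p^\epsilon$ are prime ideals of $B$ and $Z(B)=\bigcup_{\mathfrak p\in\Gamma}\mathfrak p^{\epsilon}$.
   Context: A semiring is a set $S$ with operations $+,\cdot$ such that $(S,+,0)$ and $(S,\cdot,1)$ are commutative monoids with $1\neq 0$, multiplication distributes over addition, and $s\cdot 0=0$ for all $s$. An ideal of $S$ is a nonempty subset closed under addition and under multiplication by elements of $S$; $\mathrm{Id}(S)$ is the set of ideals of $S$. A proper ideal $\mathfrak p$ is prime if $ab\in\mathfrak p$ implies $a\in\mathfrak p$ or $b\in\mathfrak p$; $\mathrm{Spec}(S)$ is the set of prime ideals. $IJ$ is the ideal of finite sums of products $xy$, $x\in I$, $y\in J$; $I^0=S$. $Z(S)$ is the set of zero-divisors of $S$, i.e. of $z\in S$ with $zs=0$ for some nonzero $s\in S$ (so $0\in Z(S)$). $\mathrm{Ass}(S)$ is the set of prime ideals of $S$ of the form $\mathrm{Ann}(s)=\{t\in S: ts=0\}$ for some $s\in S$. For a set $\Gamma\subseteq\mathrm{Spec}(S)$: $Z(S)$ is controlled by $\Gamma$ if $Z(S)=\bigcup_{\mathfrak p\in\Gamma}\mathfrak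 p$; $\Gamma$ satisfies the prime avoidance property if for every ideal $I$ of $S$, $I\subseteq\bigcup_{\mathfrak p\in\Gamma}\mathfrak p$ implies $I\subseteq\mathfrak p$ for some $\mathfrak p\in\Gamma$. An $S$-semialgebra is a semiring $B$ together with a semiring morphism $\gamma: S\to B$ (preserving $+,\cdot,0,1$); write $sf=\gamma(s)f$. An amount function is a function $A: B\to \mathrm{Id}(S)$, $f\mapsto A_f$, such that for all $s\in S$, $f,g\in B$: (1) $A_0=(0)$ and $A_1=S$; (2) $A_f=(0)$ implies $f=0$; (3) $A_{sf}=sA_f$; (4) $A_{fg}\subseteq A_fA_g$. $B$ is an amount $S$-semialgebra if: (i) there is an amount function $A: B\to\mathrm{Id}(S)$ such that for all $f,g\in B$ there are non-negative integers $m,n$ with $A_f^mA_g^nA_{fg}=A_f^{m+1}A_g^{n+1}$; and (ii) there is a function $\epsilon:\mathrm{Id}(S)\to\mathrm{Id}(B)$, $I\mapsto I^{\epsilon}$, such that $A_f\subseteq I$ if and only if $f\in I^\epsilon$ (for all $f\in B$, $I\in \mathrm{Id}(S)$), and $I^{\epsilon}\cap S=I$ for all $I$ (where $I^\epsilon\cap S$ means $\gamma^{-1}(I^\epsilon)$). $B$ is a McCoy $S$-semialgebra (with respect to $A$) if for all $f,g\in B$, $fg=0$ and $g\neq0$ imply that there is a nonzero $s\in S$ with $sA_f=(0)$. *)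

theory Defs
  imports Main
begin

(* A semiring is a type of class comm_semiring_1: the class includes 0 \<noteq> 1 and x * 0 = 0. *)

definition ideals :: "'a::comm_semiring_1 set set" where
  "ideals = {I. I \<noteq> {} \<and> (\<forall>x\<in>I. \<forall>y\<in>I. x + y \<in> I) \<and> (\<forall>s. \<forall>x\<in>I. s * x \<in> I)}"

definition Spec :: "'a::comm_semiring_1 set set" where
  "Spec = {P \<in> ideals. P \<noteq> UNIV \<and> (\<forall>a b. a * b \<in> P \<longrightarrow> a \<in> P \<or> b \<in> P)}"

definition ideal_prod :: "'a::comm_semiring_1 set \<Rightarrow> 'a set \<Rightarrow> 'a set" where
  "ideal_prod I J = {(\<Sum>(x, y)\<leftarrow>xys. x * y) | xys. set xys \<subseteq> I \<times> J}"

primrec ideal_power :: "'a::comm_semiring_1 set \<Rightarrow> nat \<Rightarrow> 'a set" where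
  "ideal_power I 0 = UNIV"
| "ideal_power I (Suc n) = ideal_prod I (ideal_power I n)"

definition zero_divisors :: "'a::comm_semiring_1 set" where
  "zero_divisors = {z. \<exists>s. s \<noteq> 0 \<and> z * s = 0}"

definition Ann :: "'a::comm_semiring_1 \<Rightarrow> 'a set" where
  "Ann s = {t. t * s = 0}"

definition Ass :: "'a::comm_semiring_1 set set" where
  "Ass = {P \<in> Spec. \<exists>s. P = Ann s}"

definition zero_divisors_controlled_by :: "'a::comm_semiring_1 set set \<Rightarrow> bool" where
  "zero_divisors_controlled_by \<Gamma> \<longleftrightarrow> \<Gamma> \<subseteq> Spec \<and> zero_divisors = \<Union>\<Gamma>"

definition prime_avoidance :: "'a::comm_semiring_1 set set \<Rightarrow> bool" where
  "prime_avoidance \<Gamma> \<longleftrightarrow> \<Gamma> \<subseteq> Spec \<and> (\<forall>I\<in>ideals. I \<subseteq> \<Union>\<Gamma> \<longrightarrow> (\<exists>P\<in>\<Gamma>. I \<subseteq> P))"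

definition semiring_morphism :: "('s::comm_semiring_1 \<Rightarrow> 'b::comm_semiring_1) \<Rightarrow> bool" where
  "semiring_morphism \<gamma> \<longleftrightarrow> \<gamma> 0 = 0 \<and> \<gamma> 1 = 1 \<and>
     (\<forall>s t. \<gamma> (s + t) = \<gamma> s + \<gamma> t) \<and> (\<forall>s t. \<gamma> (s * t) = \<gamma> s * \<gamma> t)"

(* The S-semialgebra structure on B is carried by the structure morphism \<gamma>; s f is \<gamma> s * f. *)

definition amount_function ::
    "('s::comm_semiring_1 \<Rightarrow> 'b::comm_semiring_1) \<Rightarrow> ('b \<Rightarrow> 's set) \<Rightarrow> bool" where
  "amount_function \<gamma> A \<longleftrightarrow>
     (\<forall>f. A f \<in> ideals) \<and>
     A 0 = {0} \<and> A 1 = UNIV \<and>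
     (\<forall>f. A f = {0} \<longrightarrow> f = 0) \<and>
     (\<forall>s f. A (\<gamma> s * f) = (\<lambda>x. s * x) ` A f) \<and>
     (\<forall>f g. A (f * g) \<subseteq> ideal_prod (A f) (A g))"

definition amount_semialgebra ::
    "('s::comm_semiring_1 \<Rightarrow> 'b::comm_semiring_1) \<Rightarrow> ('b \<Rightarrow> 's set) \<Rightarrow> ('s set \<Rightarrow> 'b set) \<Rightarrow> bool" where
  "amount_semialgebra \<gamma> A \<epsilon> \<longleftrightarrow>
     semiring_morphism \<gamma> \<and>
     amount_function \<gamma> A \<and>
     (\<forall>f g. \<exists>m n.
        ideal_prod (ideal_prod (ideal_power (A f) m) (ideal_power (A g) n)) (A (f * g))
          = ideal_prod (ideal_power (A f) (m + 1)) (ideal_power (A g) (n + 1))) \<and>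
     (\<forall>I\<in>ideals. \<epsilon> I \<in> ideals) \<and>
     (\<forall>I\<in>ideals. \<forall>f. A f \<subseteq> I \<longleftrightarrow> f \<in> \<epsilon> I) \<and>
     (\<forall>I\<in>ideals. \<gamma> -` \<epsilon> I = I)"

definition McCoy_semialgebra :: "('b::comm_semiring_1 \<Rightarrow> 's::comm_semiring_1 set) \<Rightarrow> bool" where
  "McCoy_semialgebra A \<longleftrightarrow>
     (\<forall>f g. f * g = 0 \<and> g \<noteq> 0 \<longrightarrow> (\<exists>s. s \<noteq> 0 \<and> (\<lambda>x. s * x) ` A f = {0}))"

end

theory Submission
  imports Defs
begin

text \<open>
  The identity \<open>A\<^sub>f\<^sup>m A\<^sub>g\<^sup>n A\<^sub>f\<^sub>g = A\<^sub>f\<^sup>m\<^sup>+\<^sup>1 A\<^sub>g\<^sup>n\<^sup>+\<^sup>1\<close> makes \<open>\<epsilon> P\<close> prime whenever \<open>P\<close> is: if \<open>a \<in> A\<^sub>f - P\<close> and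
  \<open>b \<in> A\<^sub>g - P\<close>, then \<open>a\<^sup>m\<^sup>+\<^sup>1 b\<^sup>n\<^sup>+\<^sup>1\<close> lies in the right-hand side, which is contained in \<open>P\<close> as soon as
  \<open>A\<^sub>f\<^sub>g \<subseteq> P\<close>. If \<open>f\<close> is a zero-divisor, then by the McCoy property \<open>A\<^sub>f\<close> consists of zero-divisors,
  and prime avoidance puts it into a single \<open>P \<in> \<Gamma>\<close>, i.e. \<open>f \<in> \<epsilon> P\<close>. Conversely, if
  \<open>A\<^sub>f \<subseteq> P = Ann s\<close>, then \<open>A\<^sub>s\<^sub>f = s A\<^sub>f = 0\<close>, so \<open>s f = 0\<close>.
\<close>

lemma ideal_zero:
  assumes "I \<in> ideals"
  shows "0 \<in> I"
proof -
  obtain x where "x \<in> I"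
    using assms by (auto simp: ideals_def)
  then have "0 * x \<in> I"
    using assms unfolding ideals_def by blast
  then show ?thesis
    by simp
qed

lemma ideal_prod_mult_mem:
  assumes "x \<in> I" "y \<in> J"
  shows "x * y \<in> ideal_prod I J"
  unfolding ideal_prod_def using assms by (auto intro!: exI[of _ "[(x, y)]"])

lemma ideal_power_power_mem:
  assumes "a \<in> I"
  shows "a ^ n \<in> ideal_power I n"
  by (induction n) (use assms in \<open>auto intro: ideal_prod_mult_mem\<close>)

text \<open>Each summand is absorbed by \<open>P\<close> through its right factor. Since
  \<open>I\<close> may be any set, this applies to a product of ideal powers without first showing
  that product to be an ideal.\<close>

lemma ideal_prod_subset_right:
  assumes P: "P \<in> ideals" and "J \<subseteq> P"
  shows "ideal_prod I J \<subseteq> P"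
proof -
  have "(\<Sum>(x, y)\<leftarrow>xys. x * y) \<in> P" if "set xys \<subseteq> I \<times> J" for xys
    using that
  proof (induction xys)
    case Nil
    then show ?case
      using ideal_zero[OF P] by simp
  next
    case (Cons xy xys)
    then have "fst xy * snd xy \<in> P"
      using assms unfolding ideals_def by auto
    then show ?case
      using Cons P unfolding ideals_def by (simp add: case_prod_beta)
  qed
  then show ?thesis
    by (auto simp: ideal_prod_def)
qed

lemma prime_ideal_power_mem:
  assumes P: "P \<in> Spec" and "a ^ n \<in> P"
  shows "a \<in> P"
  using assms(2)
proof (induction n)
  case 0
  \<comment> \<open>Exponent 0 can occur: then 1 lies in \<open>P\<close>, and absorption puts
    \<open>a\<close> there.\<close>
  then have "a * 1 \<in> P"
    using P unfolding Spec_def ideals_def power_0 by blast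
  then show ?case
    by simp
next
  case (Suc n)
  then show ?case
    using P by (auto simp: Spec_def)
qed

lemma extension_prime:
  assumes B: "amount_semialgebra \<gamma> A \<epsilon>" and P: "P \<in> Spec"
  shows "\<epsilon> P \<in> Spec"
proof -
  have PI: "P \<in> ideals" and "P \<noteq> UNIV"
    using P by (auto simp: Spec_def)
  have \<epsilon>_iff: "f \<in> \<epsilon> P \<longleftrightarrow> A f \<subseteq> P" for f
    using B PI unfolding amount_semialgebra_def by blast
  have "A 1 = UNIV"
    using B by (simp add: amount_semialgebra_def amount_function_def)
  \<comment> \<open>This is what makes \<open>\<epsilon> P\<close> proper.\<close>
  then have "1 \<notin> \<epsilon> P"
    using \<open>P \<noteq> UNIV\<close> by (auto simp: \<epsilon>_iff)
  moreover have "f \<in> \<epsilon> P \<or> g \<in> \<epsilon> P" if "f * g \<in> \<epsilon> P" for f g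
  proof (rule ccontr)
    assume "\<not> (f \<in> \<epsilon> P \<or> g \<in> \<epsilon> P)"
    then obtain a b where ab: "a \<in> A f" "a \<notin> P" "b \<in> A g" "b \<notin> P"
      by (auto simp: \<epsilon>_iff)
    have "\<forall>f g. \<exists>m n.
        ideal_prod (ideal_prod (ideal_power (A f) m) (ideal_power (A g) n)) (A (f * g))
          = ideal_prod (ideal_power (A f) (m + 1)) (ideal_power (A g) (n + 1))"
      using B unfolding amount_semialgebra_def by (elim conjE)
    then obtain m n where mn:
      "ideal_prod (ideal_prod (ideal_power (A f) m) (ideal_power (A g) n)) (A (f * g))
        = ideal_prod (ideal_power (A f) (m + 1)) (ideal_power (A g) (n + 1))"
      by meson
    have "a ^ (m + 1) * b ^ (n + 1) \<in> ideal_prod (ideal_power (A f) (m + 1)) (ideal_power (A g) (n + 1))"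
      by (intro ideal_prod_mult_mem ideal_power_power_mem ab)
    also have "\<dots> \<subseteq> P"
      using that unfolding mn[symmetric] \<epsilon>_iff by (rule ideal_prod_subset_right[OF PI])
    finally have "a ^ (m + 1) \<in> P \<or> b ^ (n + 1) \<in> P"
      using P unfolding Spec_def by blast
    then show False
      using ab prime_ideal_power_mem[OF P] by blast
  qed
  moreover have "\<epsilon> P \<in> ideals"
    using B PI by (simp add: amount_semialgebra_def)
  ultimately show ?thesis
    by (auto simp: Spec_def)
qed

text \<open>The amount of \<open>\<gamma> s * 1\<close> is the principal ideal of \<open>s\<close>,
  which contains \<open>s\<close>, whereas \<open>A 0\<close> is zero. Thus
  \<open>\<gamma> s\<close> can serve as the nonzero cofactor of a zero-divisor in
  \<open>B\<close>.\<close>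

lemma structure_morphism_nonzero:
  assumes A: "amount_function \<gamma> A" and "s \<noteq> 0"
  shows "\<gamma> s \<noteq> 0"
proof
  assume "\<gamma> s = 0"
  have "A (\<gamma> s * 1) = (\<lambda>x. s * x) ` A 1"
    using A by (simp add: amount_function_def del: mult_1_right)
  moreover have "A 0 = {0}" "A 1 = UNIV"
    using A by (simp_all add: amount_function_def)
  ultimately have "range (\<lambda>x. s * x) = {0}"
    using \<open>\<gamma> s = 0\<close> by simp
  then have "s * 1 \<in> {0}"
    by blast
  with \<open>s \<noteq> 0\<close> show False
    by simp
qed

theorem theorem5p1:
  fixes \<Gamma> :: "'s::comm_semiring_1 set set"
    and \<gamma> :: "'s \<Rightarrow> 'b::comm_semiring_1"
    and A :: "'b \<Rightarrow> 's set"
    and \<epsilon> :: "'s set \<Rightarrow> 'b set"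
  assumes "\<Gamma> \<subseteq> Ass"
    and "prime_avoidance \<Gamma>"
    and "amount_semialgebra \<gamma> A \<epsilon>"
    and "zero_divisors_controlled_by \<Gamma>"
    and "McCoy_semialgebra A"
  shows "zero_divisors_controlled_by (\<epsilon> ` \<Gamma>)"
proof -
  have \<Gamma>: "\<Gamma> \<subseteq> Spec" and Z: "zero_divisors = \<Union>\<Gamma>"
    using assms(4) by (auto simp: zero_divisors_controlled_by_def)
  have A: "amount_function \<gamma> A"
    using assms(3) by (simp add: amount_semialgebra_def)
  then have AI: "A f \<in> ideals" for f
    by (simp add: amount_function_def)
  have \<epsilon>_iff: "f \<in> \<epsilon> P \<longleftrightarrow> A f \<subseteq> P" if "P \<in> \<Gamma>" for P f
  proof -
    have "P \<in> ideals"
      using that \<Gamma> by (auto simp: Spec_def)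
    then show ?thesis
      using assms(3) unfolding amount_semialgebra_def by blast
  qed
  have "zero_divisors = \<Union>(\<epsilon> ` \<Gamma>)"
  proof (intro equalityI subsetI)
    fix f :: 'b
    assume "f \<in> zero_divisors"
    then obtain s where s: "s \<noteq> 0" "(\<lambda>x. s * x) ` A f = {0}"
      using assms(5) unfolding zero_divisors_def McCoy_semialgebra_def by blast
    have "x * s = 0" if "x \<in> A f" for x
      using that s(2) by (auto simp: mult.commute)
    then have "A f \<subseteq> zero_divisors"
      using s(1) by (auto simp: zero_divisors_def)
    then obtain P where "P \<in> \<Gamma>" "A f \<subseteq> P"
      using assms(2) AI unfolding Z prime_avoidance_def by blast
    then show "f \<in> \<Union>(\<epsilon> ` \<Gamma>)"
      using \<epsilon>_iff by blast
  next
    fix f :: 'b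
    assume "f \<in> \<Union>(\<epsilon> ` \<Gamma>)"
    then obtain P where P: "P \<in> \<Gamma>" "A f \<subseteq> P"
      using \<epsilon>_iff by blast
    then obtain s where s: "P = Ann s"
      using assms(1) by (auto simp: Ass_def)
    \<comment> \<open>\<open>Ann 0\<close> is the whole semiring, but a prime ideal is
      proper.\<close>
    have "s \<noteq> 0"
      using P(1) \<Gamma> s by (auto simp: Spec_def Ann_def)
    have "s * x = 0" if "x \<in> A f" for x
      using that P(2) by (auto simp: s Ann_def mult.commute)
    \<comment> \<open>Equality also requires the image to be nonempty, which 0 in \<open>A f\<close>
      ensures.\<close>
    then have "(\<lambda>x. s * x) ` A f = {0}"
      using ideal_zero[OF AI] by force
    then have "A (\<gamma> s * f) = {0}"
      using A by (simp add: amount_function_def)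
    then have "\<gamma> s * f = 0"
      using A unfolding amount_function_def by blast
    then have "f * \<gamma> s = 0"
      by (simp add: mult.commute)
    then show "f \<in> zero_divisors"
      using structure_morphism_nonzero[OF A \<open>s \<noteq> 0\<close>] by (auto simp: zero_divisors_def)
  qed
  moreover have "\<epsilon> ` \<Gamma> \<subseteq> Spec"
    using extension_prime[OF assms(3)] \<Gamma> by blast
  ultimately show ?thesis
    by (simp add: zero_divisors_controlled_by_def)
qed

end
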